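(* Let $\mathcal{A}$ be a parametric timed automaton with parameter set $\mathbb{P}$, private location $\ell_{priv}$ and final location $\ell_f$. Let $\mathrm{d}\text{-}\exists\mathrm{OS}(\mathcal{A})$ be the set of pairs $(v,d)$ such that $v(\mathcal{A})$ is $\exists$-ET-opaque and is ET-opaque for the execution time $d$, and let $\mathrm{d}\text{-}\mathrm{FOS}(\mathcal{A})$ be the set of pairs $(v,d)$ such that $v(\mathcal{A})$ is fully ET-opaque and $d$ is the duration of a (private or public) run of $v(\mathcal{A})$. Let $$\mathit{Diff}(\mathcal{A})=\Big(\mathrm{PET}(\mathcal{A}^{\ell_{priv}}_{\ell_f})\cup\mathrm{PET}(\mathcal{A}^{\neg\ell_{priv}}_{\ell_f})\Big)\setminus\Big(\mathrm{PET}(\mathcal{A}^{\ell_{priv}}_{\ell_f})\cap\mathrm{PET}(\mathcal{A}^{\neg\ell_{priv}}_{\ell_f})\Big),$$ and let $\mathit{Diff}(\mathcal{A}){\downarrow_{\mathbb{P}}}=\{v\mid\exists d,\ (v,d)\in\mathit{Diff}(\mathcal{A})\}$ be its projection onto the parameters. Then $$\mathrm{d}\text{-}\mathrm{FOS}(\mathcal{A})=\mathrm{d}\text{-}\exists\mathrm{OS}(\mathcal{A})\setminus\mathit{Diff}(\mathcal{A}){\downarrow_{\mathbb{P}}},$$ where the right-hand side denotes the set of $(v,d)\in\mathrm{d}\text{-}\exists\mathrm{OS}(\mathcal{A})$ with $v\notin\mathit{Diff}(\mathcal{A}){\downarrow_{\mathbb{P}}}$.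
   Context: Clocks and delays take values in $\mathbb{R}_{\ge 0}$; a parameter valuation is a function $v:\mathbb{P}\to\mathbb{N}$. A parametric timed automaton (PTA) is a tuple $\mathcal{A}=(\Sigma,L,\ell_0,\ell_{priv},\ell_f,\mathbb{X},\mathbb{P},I,E)$ with finite sets $\Sigma$ of actions and $L$ of locations, initial, private and final locations $\ell_0,\ell_{priv},\ell_f\in L$, finite sets $\mathbb{X}$ of clocks and $\mathbb{P}=\{p_1,\dots,p_M\}$ of parameters, an invariant $I$ assigning a clock guard to every location, and a finite set $E$ of edges $(\ell,g,a,R,\ell')$ with $g$ a clock guard, $a\in\Sigma$, and $R\subseteq\mathbb{X}$ the clocks reset to $0$. A clock guard is a conjunction of inequalities $x\bowtie\sum_i\alpha_i p_i+\gamma$ with $x\in\mathbb{X}$, $\alpha_i,\gamma\in\mathbb{Z}$, ${\bowtie}\in\{<,\le,=,\ge,>\}$. For a parameter valuation $v$, $v(\mathcal{A})$ is the timed automaton obtained by replacing each $p_i$ by $v(p_i)$. Its states are pairs $(\ell,\mu)$ with $\mu$ a clock valuation satisfying $v(I(\ell))$; the initial state is $(\ell_0,\vec 0)$. A step $(\ell,\mu)\xrightarrow{(\delta,e)}(\ell',\mu')$ with $e=(\ell,g,a,R,\ell')$ consists of a delay $\delta\ge 0$ in $\ell$ (all clocks increase by $\delta$, the invariant holding throughout) followed by taking $e$ (the guard must hold, clocks in $R$ are reset to $0$, and the resulting state must satisfy the invariant of $\ell'$). A finite run starts from the initial state and has the form $(\ell_0,\mu_0),(\delta_0,e_0),\dots,(\ell_n,\mu_n)$;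 its duration is $\sum_{i<n}\delta_i$. A private run is a run with $\ell_n=\ell_f$, $\ell_i\ne\ell_f$ for all $i<n$, and $\ell_m=\ell_{priv}$ for some $m<n$. A public run is a run with $\ell_n=\ell_f$ and $\ell_i\notin\{\ell_{priv},\ell_f\}$ for all $i<n$. Let $D^{priv}(v)$ and $D^{pub}(v)$ be the sets of durations of private, resp. public, runs of $v(\mathcal{A})$. $v(\mathcal{A})$ is ET-opaque for the execution time $d$ if $d\in D^{priv}(v)\cap D^{pub}(v)$; it is $\exists$-ET-opaque if $D^{priv}(v)\cap D^{pub}(v)\ne\emptyset$; it is fully ET-opaque if $D^{priv}(v)=D^{pub}(v)$. $\mathrm{PET}(\mathcal{B})$, for a PTA $\mathcal{B}$ with final location $\ell_f$, is the set of pairs $(v,d)$ such that $v(\mathcal{B})$ has a finite run of duration $d$ with $\ell_n=\ell_f$ and $\ell_i\ne\ell_f$ for all $0\le i\le n-1$. $\mathcal{A}^{\ell_{priv}}_{\ell_f}$ is a copy of $\mathcal{A}$ such that a Boolean variable $b$ (syntactic sugar for doubling the number of locations) is added and initialized to False, $b$ is set to True on all incoming edges to $\ell_{priv}$, and a guard $b=\mathrm{True}$ is added to all incoming edges to $\ell_f$. $\mathcal{A}^{\neg\ell_{priv}}_{\ell_f}$ is a copy of $\mathcal{A}$ in which all incoming and outgoing edges to and from $\ell_{priv}$ are pruned. *)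

theory Defs
  imports Complex_Main "HOL-Library.FuncSet"
begin

datatype cmp = Lt | Le | Eq | Ge | Gt

fun cmp_holds :: "cmp \<Rightarrow> real \<Rightarrow> real \<Rightarrow> bool" where
  "cmp_holds Lt r s \<longleftrightarrow> r < s"
| "cmp_holds Le r s \<longleftrightarrow> r \<le> s"
| "cmp_holds Eq r s \<longleftrightarrow> r = s"
| "cmp_holds Ge r s \<longleftrightarrow> r \<ge> s"
| "cmp_holds Gt r s \<longleftrightarrow> r > s"

text \<open>
  Constraints and automata are polymorphic in the type \<open>'t\<close> of the right-hand sides of
  inequalities: linear terms over parameters for parametric timed automata, and integers
  for timed automata. A guard is the conjunction of the inequalities in the list.
\<close>

datatype ('c, 't) ineq = Ineq (clk: 'c) (rel: cmp) (rhs: 't)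

type_synonym ('c, 't) guard = "('c, 't) ineq list"

datatype 'p linterm = LinTerm (coeff: "'p \<Rightarrow> int") (const: int)

definition lin_eval :: "'p set \<Rightarrow> ('p \<Rightarrow> nat) \<Rightarrow> 'p linterm \<Rightarrow> int" where
  "lin_eval P v t = (\<Sum>p\<in>P. coeff t p * int (v p)) + const t"

type_synonym ('l, 'a, 'c, 't) edge = "'l \<times> ('c, 't) guard \<times> 'a \<times> 'c set \<times> 'l"

record ('l, 'a, 'c, 't) automaton =
  actions :: "'a set"
  locs :: "'l set"
  init :: 'l
  priv :: 'l
  final :: 'l
  clocks :: "'c set"
  invar :: "'l \<Rightarrow> ('c, 't) guard"
  edges :: "('l, 'a, 'c, 't) edge set"

type_synonym ('l, 'a, 'c) ta = "('l, 'a, 'c, int) automaton"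

record ('l, 'a, 'c, 'p) pta = "('l, 'a, 'c, 'p linterm) automaton" +
  params :: "'p set"

definition guard_over :: "'c set \<Rightarrow> ('c, 't) guard \<Rightarrow> bool" where
  "guard_over X g \<longleftrightarrow> (\<forall>c\<in>set g. clk c \<in> X)"

definition wf_pta :: "('l, 'a, 'c, 'p) pta \<Rightarrow> bool" where
  "wf_pta A \<longleftrightarrow>
     finite (actions A) \<and> finite (locs A) \<and> finite (clocks A) \<and> finite (params A) \<and>
     init A \<in> locs A \<and> priv A \<in> locs A \<and> final A \<in> locs A \<and>
     (\<forall>l\<in>locs A. guard_over (clocks A) (invar A l)) \<and>
     finite (edges A) \<and>
     (\<forall>(l, g, a, R, l')\<in>edges A.
        l \<in> locs A \<and> guard_over (clocks A) g \<and> a \<in> actions A \<and> R \<subseteq> clocks A \<and> l' \<in> locs A)"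

text \<open>
  Parameter valuations are functions from the parameter set to the naturals, represented as
  extensional functions so that distinct HOL functions are distinct valuations.
\<close>

definition valuations :: "('l, 'a, 'c, 'p) pta \<Rightarrow> ('p \<Rightarrow> nat) set" where
  "valuations A = params A \<rightarrow>\<^sub>E UNIV"

definition inst_guard :: "'p set \<Rightarrow> ('p \<Rightarrow> nat) \<Rightarrow> ('c, 'p linterm) guard \<Rightarrow> ('c, int) guard" where
  "inst_guard P v g = map (map_ineq id (lin_eval P v)) g"

definition instantiate :: "('p \<Rightarrow> nat) \<Rightarrow> ('l, 'a, 'c, 'p) pta \<Rightarrow> ('l, 'a, 'c) ta" where
  "instantiate v A =
     \<lparr> actions = actions A, locs = locs A, init = init A, priv = priv A, final = final A,
       clocks = clocks A,
       invar = (\<lambda>l. inst_guard (params A) v (invar A l)),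
       edges = {(l, inst_guard (params A) v g, a, R, l') | l g a R l'. (l, g, a, R, l') \<in> edges A} \<rparr>"


subsection \<open>Semantics of timed automata\<close>

type_synonym 'c cval = "'c \<Rightarrow> real"

definition sat :: "'c cval \<Rightarrow> ('c, int) guard \<Rightarrow> bool" where
  "sat \<mu> g \<longleftrightarrow> (\<forall>c\<in>set g. cmp_holds (rel c) (\<mu> (clk c)) (of_int (rhs c)))"

text \<open>
  Clock valuations of an automaton with clock set \<open>X\<close> are extensional on \<open>X\<close>; all operations
  below preserve this.
\<close>

definition zero_val :: "'c set \<Rightarrow> 'c cval" where
  "zero_val X = (\<lambda>x\<in>X. 0)"

definition delay :: "'c set \<Rightarrow> 'c cval \<Rightarrow> real \<Rightarrow> 'c cval" where
  "delay X \<mu> \<delta> = (\<lambda>x\<in>X. \<mu> x + \<delta>)"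

definition reset :: "'c set \<Rightarrow> 'c cval \<Rightarrow> 'c set \<Rightarrow> 'c cval" where
  "reset X \<mu> R = (\<lambda>x\<in>X. if x \<in> R then 0 else \<mu> x)"

definition step ::
  "('l, 'a, 'c) ta \<Rightarrow> 'l \<times> 'c cval \<Rightarrow> real \<Rightarrow> ('l, 'a, 'c, int) edge \<Rightarrow> 'l \<times> 'c cval \<Rightarrow> bool" where
  "step T s \<delta> e s' \<longleftrightarrow>
     (case (s, e, s') of ((l, \<mu>), (l1, g, a, R, l2), (l', \<mu>')) \<Rightarrow>
        e \<in> edges T \<and> l1 = l \<and> l2 = l' \<and> \<delta> \<ge> 0 \<and>
        (\<forall>t\<in>{0..\<delta>}. sat (delay (clocks T) \<mu> t) (invar T l)) \<and>
        sat (delay (clocks T) \<mu> \<delta>) g \<and>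
        \<mu>' = reset (clocks T) (delay (clocks T) \<mu> \<delta>) R \<and>
        sat \<mu>' (invar T l'))"

text \<open>
  \<open>run T n s \<delta> e\<close>: the sequence \<open>s 0, (\<delta> 0, e 0), \<dots>, s n\<close> is a finite run. The values of
  \<open>s\<close> beyond \<open>n\<close>, and of \<open>\<delta>\<close> and \<open>e\<close> from \<open>n\<close> on, are irrelevant. The initial pair must itself
  be a state, i.e. satisfy the invariant of the initial location.
\<close>

definition run ::
  "('l, 'a, 'c) ta \<Rightarrow> nat \<Rightarrow> (nat \<Rightarrow> 'l \<times> 'c cval) \<Rightarrow> (nat \<Rightarrow> real) \<Rightarrow>
   (nat \<Rightarrow> ('l, 'a, 'c, int) edge) \<Rightarrow> bool" where
  "run T n s \<delta> e \<longleftrightarrow>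
     s 0 = (init T, zero_val (clocks T)) \<and>
     sat (zero_val (clocks T)) (invar T (init T)) \<and>
     (\<forall>i<n. step T (s i) (\<delta> i) (e i) (s (Suc i)))"

definition private_durations :: "('l, 'a, 'c) ta \<Rightarrow> real set" where
  "private_durations T =
     {\<Sum>i<n. \<delta> i | n s \<delta> e. run T n s \<delta> e \<and>
        fst (s n) = final T \<and> (\<forall>i<n. fst (s i) \<noteq> final T) \<and> (\<exists>m<n. fst (s m) = priv T)}"

definition public_durations :: "('l, 'a, 'c) ta \<Rightarrow> real set" where
  "public_durations T =
     {\<Sum>i<n. \<delta> i | n s \<delta> e. run T n s \<delta> e \<and>
        fst (s n) = final T \<and> (\<forall>i<n. fst (s i) \<notin> {priv T, final T})}"

definition ET_opaque_for :: "('l, 'a, 'c) ta \<Rightarrow> real \<Rightarrow> bool" where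
  "ET_opaque_for T d \<longleftrightarrow> d \<in> private_durations T \<inter> public_durations T"

definition exists_ET_opaque :: "('l, 'a, 'c) ta \<Rightarrow> bool" where
  "exists_ET_opaque T \<longleftrightarrow> private_durations T \<inter> public_durations T \<noteq> {}"

definition fully_ET_opaque :: "('l, 'a, 'c) ta \<Rightarrow> bool" where
  "fully_ET_opaque T \<longleftrightarrow> private_durations T = public_durations T"


subsection \<open>Parametric sets\<close>

definition d_exists_OS :: "('l, 'a, 'c, 'p) pta \<Rightarrow> (('p \<Rightarrow> nat) \<times> real) set" where
  "d_exists_OS A =
     {(v, d). v \<in> valuations A \<and> exists_ET_opaque (instantiate v A) \<and>
              ET_opaque_for (instantiate v A) d}"

definition d_FOS :: "('l, 'a, 'c, 'p) pta \<Rightarrow> (('p \<Rightarrow> nat) \<times> real) set" where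
  "d_FOS A =
     {(v, d). v \<in> valuations A \<and> fully_ET_opaque (instantiate v A) \<and>
              d \<in> private_durations (instantiate v A) \<union> public_durations (instantiate v A)}"

definition PET :: "('l, 'a, 'c, 'p) pta \<Rightarrow> (('p \<Rightarrow> nat) \<times> real) set" where
  "PET B =
     {(v, \<Sum>i<n. \<delta> i) | v n s \<delta> e. v \<in> valuations B \<and> run (instantiate v B) n s \<delta> e \<and>
        fst (s n) = final B \<and> (\<forall>i<n. fst (s i) \<noteq> final B)}"

text \<open>
  The Boolean \<open>b\<close> is the second component of a location. It is tested before being updated, so
  an edge into \<open>final A\<close> requires \<open>b\<close> at its source. As a consequence \<open>(final A, False)\<close> is
  reachable only if it is the initial location, and \<open>(final A, True)\<close> is the relevant copy of
  the final location otherwise. The choice of \<open>final\<close> below hence makes the first visit to it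
  the first visit to any copy of \<open>final A\<close>, whether or not \<open>init A = final A\<close>. The value
  of \<open>priv\<close> plays no role in \<open>PET\<close>.
\<close>

definition via_priv :: "('l, 'a, 'c, 'p) pta \<Rightarrow> ('l \<times> bool, 'a, 'c, 'p) pta" where
  "via_priv A =
     \<lparr> actions = actions A, locs = locs A \<times> UNIV,
       init = (init A, False), priv = (priv A, True), final = (final A, init A \<noteq> final A),
       clocks = clocks A,
       invar = (\<lambda>(l, b). invar A l),
       edges = {((l, b), g, a, R, (l', b \<or> l' = priv A)) | l b g a R l'.
                  (l, g, a, R, l') \<in> edges A \<and> (l' = final A \<longrightarrow> b)},
       params = params A \<rparr>"

definition avoid_priv :: "('l, 'a, 'c, 'p) pta \<Rightarrow> ('l, 'a, 'c, 'p) pta" where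
  "avoid_priv A =
     A\<lparr> edges := {(l, g, a, R, l') | l g a R l'.
                    (l, g, a, R, l') \<in> edges A \<and> l \<noteq> priv A \<and> l' \<noteq> priv A} \<rparr>"

lemma wf_pta_via_priv:
  assumes "wf_pta A"
  shows "wf_pta (via_priv A)"
proof -
  let ?f = "\<lambda>((l, g, a, R, l'), b). ((l, b), g, a, R, (l', b \<or> l' = priv A))"
  have "edges (via_priv A) \<subseteq> ?f ` (edges A \<times> UNIV)"
  proof
    fix x assume "x \<in> edges (via_priv A)"
    then obtain l b g a R l' where
      "x = ((l, b), g, a, R, (l', b \<or> l' = priv A))" "(l, g, a, R, l') \<in> edges A"
      unfolding via_priv_def automaton.simps pta.simps by blast
    then show "x \<in> ?f ` (edges A \<times> UNIV)"
      by (intro image_eqI[of _ _ "((l, g, a, R, l'), b)"]) auto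
  qed
  then have "finite (edges (via_priv A))"
    using assms by (auto simp: wf_pta_def intro: finite_subset)
  moreover have "\<forall>(l, g, a, R, l')\<in>edges (via_priv A).
      l \<in> locs (via_priv A) \<and> guard_over (clocks (via_priv A)) g \<and> a \<in> actions (via_priv A) \<and>
      R \<subseteq> clocks (via_priv A) \<and> l' \<in> locs (via_priv A)"
    using assms unfolding wf_pta_def via_priv_def by auto
  ultimately show ?thesis
    using assms unfolding wf_pta_def by (simp add: via_priv_def)
qed

lemma wf_pta_avoid_priv:
  assumes "wf_pta A"
  shows "wf_pta (avoid_priv A)"
proof -
  have "edges (avoid_priv A) \<subseteq> edges A"
    by (auto simp: avoid_priv_def)
  then have "finite (edges (avoid_priv A))"
    using assms by (auto simp: wf_pta_def intro: finite_subset)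
  then show ?thesis
    using assms \<open>edges (avoid_priv A) \<subseteq> edges A\<close> unfolding wf_pta_def
    by (auto simp: avoid_priv_def)
qed

definition Diff_PET :: "('l, 'a, 'c, 'p) pta \<Rightarrow> (('p \<Rightarrow> nat) \<times> real) set" where
  "Diff_PET A =
     (PET (via_priv A) \<union> PET (avoid_priv A)) - (PET (via_priv A) \<inter> PET (avoid_priv A))"

definition proj_params :: "(('p \<Rightarrow> nat) \<times> real) set \<Rightarrow> ('p \<Rightarrow> nat) set" where
  "proj_params S = {v. \<exists>d. (v, d) \<in> S}"

end

theory Submission
  imports Defs
begin

text \<open>
  If \<open>v(A)\<close> is ET-opaque for some duration, then \<open>A\<close> has both a private and a public run, which
  forces \<open>init A\<close>, \<open>priv A\<close> and \<open>final A\<close> to be pairwise distinct. In this case the Boolean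
  of \<open>via_priv A\<close> records exactly whether \<open>priv A\<close> has been visited, so \<open>PET (via_priv A)\<close> and
  \<open>PET (avoid_priv A)\<close> consist of the private and the public durations, and \<open>v\<close> is in the
  projection of their symmetric difference iff the two duration sets differ. In the degenerate
  cases, where \<open>PET (via_priv A)\<close> may fail to describe the private durations, both sides of the
  claim are empty.
\<close>

text \<open>Edges are quantified away since durations depend only on locations and delays; traces of
  \<open>A\<close>, \<open>via_priv A\<close> and \<open>avoid_priv A\<close> can then be compared
  without translating edge sequences of different types.\<close>

definition moves ::
  "('p \<Rightarrow> nat) \<Rightarrow> ('l, 'a, 'c, 'p) pta \<Rightarrow> 'l \<times> 'c cval \<Rightarrow> real \<Rightarrow> 'l \<times> 'c cval \<Rightarrow> bool" where
  "moves v A s \<delta> s' \<longleftrightarrow> (\<exists>e. step (instantiate v A) s \<delta> e s')"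

definition trace ::
  "('p \<Rightarrow> nat) \<Rightarrow> ('l, 'a, 'c, 'p) pta \<Rightarrow> nat \<Rightarrow> (nat \<Rightarrow> 'l \<times> 'c cval) \<Rightarrow> (nat \<Rightarrow> real) \<Rightarrow> bool" where
  "trace v A n s \<delta> \<longleftrightarrow> (\<exists>e. run (instantiate v A) n s \<delta> e)"

lemma instantiate_simps [simp]:
  "init (instantiate v A) = init A" "priv (instantiate v A) = priv A"
  "final (instantiate v A) = final A" "clocks (instantiate v A) = clocks A"
  "invar (instantiate v A) l = inst_guard (params A) v (invar A l)"
  by (simp_all add: instantiate_def)

lemma via_priv_simps [simp]:
  "init (via_priv A) = (init A, False)" "final (via_priv A) = (final A, init A \<noteq> final A)"
  "clocks (via_priv A) = clocks A" "params (via_priv A) = params A"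
  "invar (via_priv A) (l, b) = invar A l"
  by (simp_all add: via_priv_def)

lemma avoid_priv_simps [simp]:
  "init (avoid_priv A) = init A" "final (avoid_priv A) = final A"
  "clocks (avoid_priv A) = clocks A" "params (avoid_priv A) = params A"
  "invar (avoid_priv A) = invar A"
  by (simp_all add: avoid_priv_def)

lemma edges_via_priv_iff:
  "((l, b), g, a, R, (l', b')) \<in> edges (via_priv A) \<longleftrightarrow>
     (l, g, a, R, l') \<in> edges A \<and> (l' = final A \<longrightarrow> b) \<and> (b' \<longleftrightarrow> b \<or> l' = priv A)"
  unfolding via_priv_def by auto

lemma edges_avoid_priv_iff:
  "(l, g, a, R, l') \<in> edges (avoid_priv A) \<longleftrightarrow>
     (l, g, a, R, l') \<in> edges A \<and> l \<noteq> priv A \<and> l' \<noteq> priv A"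
  unfolding avoid_priv_def by auto

lemma moves_iff:
  "moves v A (l, \<mu>) \<delta> (l', \<mu>') \<longleftrightarrow>
     (\<exists>g a R. (l, g, a, R, l') \<in> edges A \<and> \<delta> \<ge> 0 \<and>
        (\<forall>t\<in>{0..\<delta>}. sat (delay (clocks A) \<mu> t) (inst_guard (params A) v (invar A l))) \<and>
        sat (delay (clocks A) \<mu> \<delta>) (inst_guard (params A) v g) \<and>
        \<mu>' = reset (clocks A) (delay (clocks A) \<mu> \<delta>) R \<and>
        sat \<mu>' (inst_guard (params A) v (invar A l')))"
  unfolding moves_def step_def by (force simp: instantiate_def)

lemma moves_via_priv_iff:
  "moves v (via_priv A) ((l, b), \<mu>) \<delta> ((l', b'), \<mu>') \<longleftrightarrow>
     moves v A (l, \<mu>) \<delta> (l', \<mu>') \<and> (l' = final A \<longrightarrow> b) \<and> (b' \<longleftrightarrow> b \<or> l' = priv A)"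
  unfolding moves_iff edges_via_priv_iff by auto

lemma moves_avoid_priv_iff:
  "moves v (avoid_priv A) s \<delta> s' \<longleftrightarrow>
     moves v A s \<delta> s' \<and> fst s \<noteq> priv A \<and> fst s' \<noteq> priv A"
  by (cases s; cases s') (auto simp: moves_iff edges_avoid_priv_iff)

text \<open>From right to left, choosing one edge per position yields the edge sequence of a
  run.\<close>

lemma trace_iff:
  "trace v A n s \<delta> \<longleftrightarrow>
     s 0 = (init A, zero_val (clocks A)) \<and>
     sat (zero_val (clocks A)) (inst_guard (params A) v (invar A (init A))) \<and>
     (\<forall>i<n. moves v A (s i) (\<delta> i) (s (Suc i)))"
  by (simp add: trace_def run_def moves_def del: split_paired_Ex) metis

lemma private_durations_eq:
  "private_durations (instantiate v A) =
     {\<Sum>i<n. \<delta> i | n s \<delta>. trace v A n s \<delta> \<and>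
        fst (s n) = final A \<and> (\<forall>i<n. fst (s i) \<noteq> final A) \<and> (\<exists>m<n. fst (s m) = priv A)}"
  unfolding private_durations_def trace_def by auto

lemma public_durations_eq:
  "public_durations (instantiate v A) =
     {\<Sum>i<n. \<delta> i | n s \<delta>. trace v A n s \<delta> \<and>
        fst (s n) = final A \<and> (\<forall>i<n. fst (s i) \<notin> {priv A, final A})}"
  unfolding public_durations_def trace_def by auto

lemma mem_PET_iff:
  "(v, d) \<in> PET A \<longleftrightarrow> v \<in> valuations A \<and>
     (\<exists>n s \<delta>. d = (\<Sum>i<n. \<delta> i) \<and> trace v A n s \<delta> \<and>
        fst (s n) = final A \<and> (\<forall>i<n. fst (s i) \<noteq> final A))"
  unfolding PET_def trace_def by blast

lemma valuations_via_priv [simp]: "valuations (via_priv A) = valuations A"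
  and valuations_avoid_priv [simp]: "valuations (avoid_priv A) = valuations A"
  by (simp_all add: valuations_def)

text \<open>Pruning forbids \<open>priv A\<close> as source and as target of a move; the sources of
  a trace are exactly its positions before \<open>n\<close>, where a public run must avoid
  \<open>priv A\<close>.\<close>

lemma PET_avoid_priv_iff:
  assumes "priv A \<noteq> final A"
  shows "(v, d) \<in> PET (avoid_priv A) \<longleftrightarrow>
    v \<in> valuations A \<and> d \<in> public_durations (instantiate v A)"
proof -
  have "trace v (avoid_priv A) n s \<delta> \<and> (\<forall>i<n. fst (s i) \<noteq> final A) \<longleftrightarrow>
      trace v A n s \<delta> \<and> (\<forall>i<n. fst (s i) \<notin> {priv A, final A})"
    if fin: "fst (s n) = final A" for n s \<delta>
  proof -
    \<comment> \<open>A target is either a later source or, at position \<open>n\<close>, the final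
      location, which differs from \<open>priv A\<close> by assumption.\<close>
    have "fst (s (Suc i)) \<noteq> priv A"
      if "i < n" "\<forall>i<n. fst (s i) \<noteq> priv A" for i
      using that fin assms by (metis Suc_lessI)
    then show ?thesis
      by (auto simp: trace_iff moves_avoid_priv_iff)
  qed
  then show ?thesis
    unfolding mem_PET_iff public_durations_eq by auto metis+
qed

definition erase_flag :: "('l \<times> bool) \<times> 'c cval \<Rightarrow> 'l \<times> 'c cval" where
  "erase_flag s = (fst (fst s), snd s)"

text \<open>Position 0 counts as a visit here, whereas the Boolean of \<open>via_priv\<close> starts
  as False; the two agree at the start iff the initial location is not \<open>p\<close>.\<close>

definition add_flag :: "'l \<Rightarrow> (nat \<Rightarrow> 'l \<times> 'c cval) \<Rightarrow> nat \<Rightarrow> ('l \<times> bool) \<times> 'c cval" where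
  "add_flag p s i = ((fst (s i), \<exists>m\<le>i. fst (s m) = p), snd (s i))"

lemma trace_via_privD:
  assumes "trace v (via_priv A) n s \<delta>"
  shows "trace v A n (erase_flag \<circ> s) \<delta>"
    and "\<And>i. i < n \<Longrightarrow> fst (fst (s (Suc i))) = final A \<Longrightarrow> snd (fst (s i))"
    and "\<And>i. i < n \<Longrightarrow>
      snd (fst (s (Suc i))) \<longleftrightarrow> snd (fst (s i)) \<or> fst (fst (s (Suc i))) = priv A"
proof -
  have mv: "moves v A (erase_flag (s i)) (\<delta> i) (erase_flag (s (Suc i))) \<and>
      (fst (fst (s (Suc i))) = final A \<longrightarrow> snd (fst (s i))) \<and>
      (snd (fst (s (Suc i))) \<longleftrightarrow> snd (fst (s i)) \<or> fst (fst (s (Suc i))) = priv A)"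
    if "i < n" for i
    using assms that
      moves_via_priv_iff[of v A "fst (fst (s i))" "snd (fst (s i))" "snd (s i)" "\<delta> i"
        "fst (fst (s (Suc i)))" "snd (fst (s (Suc i)))" "snd (s (Suc i))"]
    by (simp add: trace_iff erase_flag_def)
  then show "trace v A n (erase_flag \<circ> s) \<delta>"
    using assms by (auto simp: trace_iff erase_flag_def)
  show "\<And>i. i < n \<Longrightarrow> fst (fst (s (Suc i))) = final A \<Longrightarrow> snd (fst (s i))"
    and "\<And>i. i < n \<Longrightarrow>
      snd (fst (s (Suc i))) \<longleftrightarrow> snd (fst (s i)) \<or> fst (fst (s (Suc i))) = priv A"
    using mv by blast+
qed

text \<open>The Boolean starts as False and becomes True only on entering \<open>priv A\<close>. The
  converse can fail if \<open>init A = priv A\<close>.\<close>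

lemma via_priv_flag_imp_visited:
  assumes "trace v (via_priv A) n s \<delta>" and "i \<le> n" and "snd (fst (s i))"
  shows "\<exists>m\<le>i. fst (fst (s m)) = priv A"
  using assms(2,3)
proof (induction i)
  case 0
  then show ?case using assms(1) by (simp add: trace_iff)
next
  case (Suc i)
  then show ?case
    using trace_via_privD(3)[OF assms(1), of i] by (metis Suc_leD Suc_le_lessD le_Suc_eq order_refl)
qed

text \<open>Erasing the Boolean turns accepting traces of \<open>via_priv A\<close> into private
  ones; recomputing it from the visits to \<open>priv A\<close> goes back.\<close>

lemma PET_via_priv_iff:
  assumes "priv A \<noteq> final A" and "init A \<noteq> final A" and "init A \<noteq> priv A"
  shows "(v, d) \<in> PET (via_priv A) \<longleftrightarrow>
    v \<in> valuations A \<and> d \<in> private_durations (instantiate v A)"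
proof (intro iffI conjI)
  assume pet: "(v, d) \<in> PET (via_priv A)"
  then show "v \<in> valuations A" by (simp add: mem_PET_iff)
  from pet obtain n s \<delta> where d: "d = (\<Sum>i<n. \<delta> i)" and tr: "trace v (via_priv A) n s \<delta>"
    and fin: "fst (s n) = (final A, True)" and nf: "\<forall>i<n. fst (s i) \<noteq> (final A, True)"
    using assms(2) by (auto simp: mem_PET_iff)
  obtain m where "m \<le> n" "fst (fst (s m)) = priv A"
    using via_priv_flag_imp_visited[OF tr order_refl] fin by auto
  \<comment> \<open>The visit is strictly before \<open>n\<close> because the last location is
    final, hence not private.\<close>
  then have "m < n \<and> fst ((erase_flag \<circ> s) m) = priv A"
    using fin assms(1) by (cases "m = n") (auto simp: erase_flag_def)
  moreover have fin_erased: "fst ((erase_flag \<circ> s) n) = final A"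
    using fin by (simp add: erase_flag_def)
  \<comment> \<open>\<open>nf\<close> excludes only the True copy of \<open>final A\<close>. The
    other copy cannot be entered: the edge requires the Boolean at its source, and it is never
    unset.\<close>
  moreover have "fst ((erase_flag \<circ> s) i) \<noteq> final A" if "i < n" for i
  proof
    assume *: "fst ((erase_flag \<circ> s) i) = final A"
    show False
    proof (cases i)
      case 0
      then show False using * tr assms(2) by (simp add: erase_flag_def trace_iff)
    next
      case (Suc j)
      then have "snd (fst (s i))"
        using * that trace_via_privD(2,3)[OF tr, of j] by (simp add: erase_flag_def)
      then show False
        using * nf that by (auto simp: erase_flag_def prod_eq_iff)
    qed
  qed
  ultimately show "d \<in> private_durations (instantiate v A)"
    using d trace_via_privD(1)[OF tr] fin_erased unfolding private_durations_eq by blast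
next
  assume "v \<in> valuations A \<and> d \<in> private_durations (instantiate v A)"
  then obtain n s \<delta> m where v: "v \<in> valuations A" and d: "d = (\<Sum>i<n. \<delta> i)"
    and tr: "trace v A n s \<delta>" and fin: "fst (s n) = final A"
    and nf: "\<forall>i<n. fst (s i) \<noteq> final A" and m: "m < n" "fst (s m) = priv A"
    unfolding private_durations_eq by auto
  let ?s = "add_flag (priv A) s"
  have "moves v (via_priv A) (?s i) (\<delta> i) (?s (Suc i))" if "i < n" for i
  proof -
    \<comment> \<open>By \<open>nf\<close> the final location is entered only at
      \<open>Suc i = n\<close>, so the private visit at \<open>m < n\<close> has already happened at
      the source.\<close>
    have "fst (s (Suc i)) = final A \<longrightarrow> (\<exists>m\<le>i. fst (s m) = priv A)"
      using nf m that by (metis Suc_lessI less_Suc_eq_le)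
    moreover have "(\<exists>m\<le>Suc i. fst (s m) = priv A) \<longleftrightarrow>
        (\<exists>m\<le>i. fst (s m) = priv A) \<or> fst (s (Suc i)) = priv A"
      by (auto simp: le_Suc_eq)
    ultimately show ?thesis
      using tr that unfolding add_flag_def moves_via_priv_iff trace_iff by simp
  qed
  then have "trace v (via_priv A) n ?s \<delta>"
    using tr assms(3) by (auto simp: trace_iff add_flag_def)
  moreover have "fst (?s n) = final (via_priv A)"
    using fin m assms(2) by (auto simp: add_flag_def intro: less_imp_le)
  moreover have "\<forall>i<n. fst (?s i) \<noteq> final (via_priv A)"
    using nf by (simp add: add_flag_def)
  ultimately show "(v, d) \<in> PET (via_priv A)"
    using v d unfolding mem_PET_iff valuations_via_priv by blast
qed

text \<open>The private run meets \<open>priv A\<close> before \<open>n\<close>, where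
  \<open>final A\<close> is forbidden; so \<open>n > 0\<close>, and its start is not final
  either.\<close>

lemma locations_distinct_if_ET_opaque:
  assumes "ET_opaque_for (instantiate v A) d"
  shows "priv A \<noteq> final A" and "init A \<noteq> final A" and "init A \<noteq> priv A"
proof -
  obtain n s \<delta> m where "trace v A n s \<delta>" "\<forall>i<n. fst (s i) \<noteq> final A" "m < n" "fst (s m) = priv A"
    using assms unfolding ET_opaque_for_def private_durations_eq by auto
  then show *: "priv A \<noteq> final A" "init A \<noteq> final A"
    by (auto simp: trace_iff dest: spec[of _ 0])
  obtain n s \<delta> where "trace v A n s \<delta>" "fst (s n) = final A" "\<forall>i<n. fst (s i) \<noteq> priv A"
    using assms unfolding ET_opaque_for_def public_durations_eq by auto
  \<comment> \<open>Since \<open>init A\<close> is not final, the public run has positive length, so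
    its start is among the positions avoiding \<open>priv A\<close>.\<close>
  then show "init A \<noteq> priv A"
    using * by (cases n) (auto simp: trace_iff)
qed

text \<open>With the three locations distinct, the fibre of \<open>Diff_PET A\<close> over
  \<open>v\<close> is the symmetric difference of the two duration sets, which is empty iff they are
  equal.\<close>

lemma mem_proj_Diff_PET_iff:
  assumes "v \<in> valuations A" and "ET_opaque_for (instantiate v A) d"
  shows "v \<in> proj_params (Diff_PET A) \<longleftrightarrow> \<not> fully_ET_opaque (instantiate v A)"
  using assms(1) locations_distinct_if_ET_opaque[OF assms(2)]
  by (auto simp: proj_params_def Diff_PET_def PET_via_priv_iff PET_avoid_priv_iff
      fully_ET_opaque_def)

theorem proposition3:
  fixes A :: "('l, 'a, 'c, 'p) pta"
  assumes "wf_pta A"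
  shows "d_FOS A = {(v, d). (v, d) \<in> d_exists_OS A \<and> v \<notin> proj_params (Diff_PET A)}"
proof -
  \<comment> \<open>When the duration sets are equal, their union is their intersection, so
    \<open>d\<close> itself witnesses existential opacity.\<close>
  have "(v, d) \<in> d_FOS A \<longleftrightarrow> (v, d) \<in> d_exists_OS A \<and> fully_ET_opaque (instantiate v A)" for v d
    unfolding d_FOS_def d_exists_OS_def fully_ET_opaque_def exists_ET_opaque_def ET_opaque_for_def
    by auto
  moreover have "v \<in> valuations A \<and> ET_opaque_for (instantiate v A) d"
    if "(v, d) \<in> d_exists_OS A" for v d
    using that by (simp add: d_exists_OS_def)
  ultimately show ?thesis
    using mem_proj_Diff_PET_iff by blast
qed

end
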